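(* Let $(V,E,T)$ be an arborescence with thresholds, with leaf set $L$, and consider the Landslide sandpile Markov chain on $\Omega$, driven by the source operators $\sigma_\ell$ ($\ell\in L$) with probabilities $y_\ell$ and the topple operators $\tau_v$ ($v\in V$) with probabilities $x_v$. Let $\pi$ be its stationary distribution and let $P^k$ be the distribution of the chain after $k$ steps (started from any initial distribution). Put $p_x=\min\{x_v : v\in V\}$ and $n=|V|$. Then for every positive integer $k\ge (n-1)/p_x$, $$\|P^k-\pi\|\le \exp\left(-\frac{(kp_x-(n-1))^2}{2kp_x}\right),$$ where $\|P^k-\pi\|=\frac12\sum_{t\in\Omega}|P^k(t)-\pi(t)|$.
   Context: An arborescence is a finite directed tree with vertex set $V$, edge set $E$ and a special vertex $r\in V$ (the root) such that there is exactly one directed path from any vertex to $r$. For $v\in V$, $v^\downarrow=(v=v_0\to v_1\to\cdots\to v_a=r)$ denotes this path, and also its set of vertices. $V$ is partially ordered by $v\le w$ iff $v\in w^\downarrow$; the leaves are the maximal vertices (those with no incoming edge), and $L$ is the set of leaves. Each vertex $v$ has a threshold $T_v$, a positive integer. The state space is $\Omega=\{(t_v)_{v\in V} : t_v\in\mathbb{Z},\ 0\le t_v\le T_v\}$. Source operator $\sigma_\ell:\Omega\to\Omega$ for $\ell\in L$: with $\ell^\downarrow=(v_0\to\cdots\to v_a)$, let $k\ge0$ be smallest with $t_{v_k}<T_{v_k}$; then $\sigma_\ell(t)$ is $t$ with $t_{v_k}$ increased by $1$. If no such $k$ exists, $\sigma_\ell(t)=t$. Operator $\theta_v:\Omega\to\Omega$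 for $v\in V$: if $t_v=0$, then $\theta_v(t)=t$. If $t_v>0$, write $v^\downarrow=(v=v_0\to\cdots\to v_a=r)$ and let $k\ge1$ be smallest with $t_{v_k}<T_{v_k}$; then $\theta_v(t)$ is $t$ with $t_v$ decreased by $1$ and $t_{v_k}$ increased by $1$; if no such $k$ exists, $\theta_v(t)$ is $t$ with $t_v$ decreased by $1$. The Landslide topple operator is $\tau_v=\theta_v^{T_v}$ (it empties vertex $v$). Probabilities: real numbers $0<x_v,y_\ell\le1$ ($v\in V$, $\ell\in L$) with $\sum_{v\in V}x_v+\sum_{\ell\in L}y_\ell=1$. The Landslide sandpile Markov chain: at each step, from state $t$, move to $\tau_v(t)$ with probability $x_v$ and to $\sigma_\ell(t)$ with probability $y_\ell$ (probabilities leading to the same state are added). This chain is ergodic, so it has a unique stationary distribution. *)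

theory Defs
  imports "HOL-Probability.Probability_Mass_Function" "Graph_Theory.Graph_Theory"
begin

section \<open>Arborescences\<close>

text \<open>
  Graph_Theory's \<open>tree\<close> only forbids directed cycles, so trees are defined here through the
  underlying undirected graph: it is connected and has no cycle. A pair of opposite arcs would
  be a cycle of length two, hence the antisymmetry; loops are excluded by \<open>pair_digraph\<close>.
\<close>

definition undirected_cycle :: "'a pair_pre_digraph \<Rightarrow> 'a list \<Rightarrow> bool" where
  "undirected_cycle G c \<longleftrightarrow>
     3 \<le> length c \<and> distinct c \<and> vwalk (c @ [hd c]) (with_proj (mk_symmetric (with_proj G)))"

definition directed_tree :: "'a pair_pre_digraph \<Rightarrow> bool" where
  "directed_tree G \<longleftrightarrow>
     pair_digraph G \<and> antisym (parcs G) \<and>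
     Digraph_Component.connected (with_proj G) \<and> \<not> (\<exists>c. undirected_cycle G c)"

definition dipath :: "'a pair_pre_digraph \<Rightarrow> 'a \<Rightarrow> 'a list \<Rightarrow> 'a \<Rightarrow> bool" where
  "dipath G v p w \<longleftrightarrow> vpath p (with_proj G) \<and> hd p = v \<and> last p = w"

definition arborescence :: "'a pair_pre_digraph \<Rightarrow> 'a \<Rightarrow> bool" where
  "arborescence G r \<longleftrightarrow>
     directed_tree G \<and> r \<in> pverts G \<and> (\<forall>v\<in>pverts G. \<exists>!p. dipath G v p r)"

definition down_path :: "'a pair_pre_digraph \<Rightarrow> 'a \<Rightarrow> 'a \<Rightarrow> 'a list" where
  "down_path G r v = (THE p. dipath G v p r)"

definition leaves :: "'a pair_pre_digraph \<Rightarrow> 'a set" where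
  "leaves G = {v \<in> pverts G. \<not> (\<exists>u. (u, v) \<in> parcs G)}"

section \<open>States and operators\<close>

definition states :: "'a pair_pre_digraph \<Rightarrow> ('a \<Rightarrow> nat) \<Rightarrow> ('a \<Rightarrow> nat) set" where
  "states G T = (\<Pi>\<^sub>E v\<in>pverts G. {0..T v})"

text \<open>
  Put one grain on the first vertex of the list that is below its threshold; the grain is lost
  if there is none.
\<close>

definition add_grain :: "('a \<Rightarrow> nat) \<Rightarrow> 'a list \<Rightarrow> ('a \<Rightarrow> nat) \<Rightarrow> ('a \<Rightarrow> nat)" where
  "add_grain T vs t =
     (case List.find (\<lambda>w. t w < T w) vs of None \<Rightarrow> t | Some w \<Rightarrow> t(w := t w + 1))"

definition source_op ::
  "'a pair_pre_digraph \<Rightarrow> 'a \<Rightarrow> ('a \<Rightarrow> nat) \<Rightarrow> 'a \<Rightarrow> ('a \<Rightarrow> nat) \<Rightarrow> ('a \<Rightarrow> nat)" where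
  "source_op G r T l t = add_grain T (down_path G r l) t"

definition theta_op ::
  "'a pair_pre_digraph \<Rightarrow> 'a \<Rightarrow> ('a \<Rightarrow> nat) \<Rightarrow> 'a \<Rightarrow> ('a \<Rightarrow> nat) \<Rightarrow> ('a \<Rightarrow> nat)" where
  "theta_op G r T v t =
     (if t v = 0 then t else add_grain T (tl (down_path G r v)) (t(v := t v - 1)))"

definition topple_op ::
  "'a pair_pre_digraph \<Rightarrow> 'a \<Rightarrow> ('a \<Rightarrow> nat) \<Rightarrow> 'a \<Rightarrow> ('a \<Rightarrow> nat) \<Rightarrow> ('a \<Rightarrow> nat)" where
  "topple_op G r T v = theta_op G r T v ^^ T v"

section \<open>The Landslide Markov chain\<close>

datatype 'a move = Topple 'a | Source 'a

primrec apply_move ::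
  "'a pair_pre_digraph \<Rightarrow> 'a \<Rightarrow> ('a \<Rightarrow> nat) \<Rightarrow> 'a move \<Rightarrow> ('a \<Rightarrow> nat) \<Rightarrow> ('a \<Rightarrow> nat)" where
  "apply_move G r T (Topple v) = topple_op G r T v"
| "apply_move G r T (Source l) = source_op G r T l"

primrec move_weight ::
  "'a pair_pre_digraph \<Rightarrow> ('a \<Rightarrow> real) \<Rightarrow> ('a \<Rightarrow> real) \<Rightarrow> 'a move \<Rightarrow> real" where
  "move_weight G x y (Topple v) = (if v \<in> pverts G then x v else 0)"
| "move_weight G x y (Source l) = (if l \<in> leaves G then y l else 0)"

definition move_pmf ::
  "'a pair_pre_digraph \<Rightarrow> ('a \<Rightarrow> real) \<Rightarrow> ('a \<Rightarrow> real) \<Rightarrow> 'a move pmf" where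
  "move_pmf G x y = embed_pmf (move_weight G x y)"

definition landslide_kernel ::
  "'a pair_pre_digraph \<Rightarrow> 'a \<Rightarrow> ('a \<Rightarrow> nat) \<Rightarrow> ('a \<Rightarrow> real) \<Rightarrow> ('a \<Rightarrow> real) \<Rightarrow>
     ('a \<Rightarrow> nat) \<Rightarrow> ('a \<Rightarrow> nat) pmf" where
  "landslide_kernel G r T x y t = map_pmf (\<lambda>m. apply_move G r T m t) (move_pmf G x y)"

definition stationary_distribution :: "'s set \<Rightarrow> ('s \<Rightarrow> 's pmf) \<Rightarrow> 's pmf \<Rightarrow> bool" where
  "stationary_distribution S K p \<longleftrightarrow> set_pmf p \<subseteq> S \<and> bind_pmf p K = p"

definition distribution_after :: "('s \<Rightarrow> 's pmf) \<Rightarrow> 's pmf \<Rightarrow> nat \<Rightarrow> 's pmf" where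
  "distribution_after K p k = ((\<lambda>q. bind_pmf q K) ^^ k) p"

definition tv_dist :: "'s set \<Rightarrow> 's pmf \<Rightarrow> 's pmf \<Rightarrow> real" where
  "tv_dist S p q = (1/2) * (\<Sum>s\<in>S. \<bar>pmf p s - pmf q s\<bar>)"

text \<open>
  The kernel is the transition matrix of the chain: the weights form a probability distribution
  on the moves, and weights of moves leading to the same state are added.
\<close>

lemma pmf_move_pmf:
  assumes fin: "finite (pverts G)"
    and x: "\<And>v. v \<in> pverts G \<Longrightarrow> 0 < x v" and y: "\<And>l. l \<in> leaves G \<Longrightarrow> 0 < y l"
    and sum1: "(\<Sum>v\<in>pverts G. x v) + (\<Sum>l\<in>leaves G. y l) = 1"
  shows "pmf (move_pmf G x y) m = move_weight G x y m"
proof -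
  let ?A = "Topple ` pverts G \<union> Source ` leaves G"
  have finL: "finite (leaves G)" using fin by (simp add: leaves_def)
  have nonneg: "0 \<le> move_weight G x y m" for m
    using x y by (cases m) (auto intro: less_imp_le)
  have "(\<Sum>m\<in>?A. move_weight G x y m) =
      (\<Sum>m\<in>Topple ` pverts G. move_weight G x y m) + (\<Sum>m\<in>Source ` leaves G. move_weight G x y m)"
    by (rule sum.union_disjoint) (auto simp: fin finL)
  also have "\<dots> = 1"
    using sum1 by (simp add: sum.reindex inj_on_def)
  finally have s: "(\<Sum>m\<in>?A. move_weight G x y m) = 1" .
  have supp: "move_weight G x y m = 0" if "m \<notin> ?A" for m
    using that by (cases m) auto
  have "(\<integral>\<^sup>+m. ennreal (move_weight G x y m) \<partial>count_space UNIV) =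
      (\<Sum>m\<in>?A. ennreal (move_weight G x y m))"
    by (rule nn_integral_count_space') (use supp fin finL in auto)
  also have "\<dots> = 1"
    using nonneg s by (subst sum_ennreal) auto
  finally show ?thesis
    unfolding move_pmf_def by (intro pmf_embed_pmf nonneg)
qed

lemma pmf_landslide_kernel:
  assumes fin: "finite (pverts G)"
    and x: "\<And>v. v \<in> pverts G \<Longrightarrow> 0 < x v" and y: "\<And>l. l \<in> leaves G \<Longrightarrow> 0 < y l"
    and sum1: "(\<Sum>v\<in>pverts G. x v) + (\<Sum>l\<in>leaves G. y l) = 1"
  shows "pmf (landslide_kernel G r T x y t) s =
    (\<Sum>v | v \<in> pverts G \<and> topple_op G r T v t = s. x v) +
    (\<Sum>l | l \<in> leaves G \<and> source_op G r T l t = s. y l)"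
proof -
  let ?V = "{v \<in> pverts G. topple_op G r T v t = s}"
  let ?L = "{l \<in> leaves G. source_op G r T l t = s}"
  let ?M = "move_pmf G x y" and ?S = "(\<lambda>m. apply_move G r T m t) -` {s}"
  have finL: "finite (leaves G)" using fin by (simp add: leaves_def)
  have pm: "pmf ?M m = move_weight G x y m" for m
    by (rule pmf_move_pmf) (use assms in auto)
  have mem: "m \<in> ?S \<longleftrightarrow> m \<in> Topple ` ?V \<union> Source ` ?L" if "m \<in> set_pmf ?M" for m
    using that by (cases m) (auto simp: set_pmf_iff pm split: if_splits)
  have "pmf (landslide_kernel G r T x y t) s = measure ?M ?S"
    by (simp add: landslide_kernel_def pmf_map)
  also have "\<dots> = measure ?M (Topple ` ?V \<union> Source ` ?L)"
    by (rule measure_pmf.finite_measure_eq_AE) (use mem in \<open>auto simp: AE_measure_pmf_iff\<close>)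
  also have "\<dots> = (\<Sum>m\<in>Topple ` ?V \<union> Source ` ?L. pmf ?M m)"
    by (rule measure_measure_pmf_finite) (use fin finL in auto)
  also have "\<dots> = (\<Sum>m\<in>Topple ` ?V. pmf ?M m) + (\<Sum>m\<in>Source ` ?L. pmf ?M m)"
    by (rule sum.union_disjoint) (auto simp: fin finL)
  also have "\<dots> = (\<Sum>v\<in>?V. x v) + (\<Sum>l\<in>?L. y l)"
    by (simp add: sum.reindex inj_on_def pm)
  finally show ?thesis by simp
qed

end

theory Submission
  imports Defs
begin

text \<open>
  Two copies of the chain driven by the same random moves are coupled. Consider the largest set of
  vertices that is closed under moving away from the root and on which the two copies agree. Grains
  only travel towards the root, so this set never shrinks. As long as it is not all of \<open>V\<close>,
  toppling a vertex outside of it that is furthest from the root empties that vertex in both copies,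
  so each step enlarges the set with probability at least \<open>p\<^sub>x\<close>. Hence the copies differ after
  \<open>k\<close> steps with at most the probability that a binomial \<open>(k, p\<^sub>x)\<close> variable is at most
  \<open>n - 1\<close>, which is bounded by Chernoff's method.
\<close>

section \<open>Descending paths\<close>

lemma dipath_suffix:
  assumes "dipath G v (a @ w # b) r"
  shows "dipath G w (w # b) r"
  using assms vwalkI_append_r[of "w # b" a "with_proj G"]
  by (auto simp: dipath_def vpath_def)

lemma dipath_down_path:
  assumes "arborescence G r" and "v \<in> pverts G"
  shows "dipath G v (down_path G r v) r"
  unfolding down_path_def by (rule theI') (use assms in \<open>simp add: arborescence_def\<close>)

lemma down_path_eqI:
  assumes "arborescence G r" and "v \<in> pverts G" and "dipath G v p r"
  shows "down_path G r v = p"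
  unfolding down_path_def
  by (rule the1_equality) (use assms in \<open>simp_all add: arborescence_def\<close>)

lemma finite_pverts:
  assumes "arborescence G r"
  shows "finite (pverts G)"
  using assms
  by (auto simp: arborescence_def directed_tree_def pair_digraph_def pair_fin_digraph_def
      pair_fin_digraph_axioms_def)

lemma down_path_Cons:
  assumes "arborescence G r" and "v \<in> pverts G"
  obtains p where "down_path G r v = v # p"
  using dipath_down_path[OF assms] that
  by (cases "down_path G r v") (auto simp: dipath_def vpath_def vwalk_def)

lemma set_down_path_subset:
  assumes "arborescence G r" and "v \<in> pverts G"
  shows "set (down_path G r v) \<subseteq> pverts G"
  using dipath_down_path[OF assms] by (auto simp: dipath_def vpath_def vwalk_def)

lemma distinct_down_path:
  assumes "arborescence G r" and "v \<in> pverts G"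
  shows "distinct (down_path G r v)"
  using dipath_down_path[OF assms] by (auto simp: dipath_def vpath_def)

text \<open>A tail of a directed path to \<open>r\<close> is again one, and uniqueness identifies it
  with the down path of its first vertex.\<close>

lemma down_path_suffix:
  assumes "arborescence G r" and "v \<in> pverts G" and "down_path G r v = a @ w # b"
  shows "down_path G r w = w # b"
proof (rule down_path_eqI)
  show "w \<in> pverts G" using set_down_path_subset[OF assms(1,2)] assms(3) by auto
  show "dipath G w (w # b) r"
    using dipath_down_path[OF assms(1,2)] unfolding assms(3) by (rule dipath_suffix)
qed (fact assms)

text \<open>The path of \<open>w\<close> is a proper suffix of the path of \<open>v\<close>, so path
  length serves as a depth that strictly increases away from the root.\<close>

lemma length_down_path_less:
  assumes "arborescence G r" and "v \<in> pverts G" and "w \<in> set (down_path G r v)" and "w \<noteq> v"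
  shows "length (down_path G r w) < length (down_path G r v)"
proof -
  obtain a b where ab: "down_path G r v = a @ w # b" using split_list[OF assms(3)] by blast
  moreover obtain p where "down_path G r v = v # p" by (rule down_path_Cons[OF assms(1,2)])
  with ab assms(4) have "a \<noteq> []" by (cases a) auto
  ultimately show ?thesis using down_path_suffix[OF assms(1,2) ab] by simp
qed

lemma down_path_trans:
  assumes "arborescence G r" and "v \<in> pverts G"
    and "w \<in> set (down_path G r v)" and "u \<in> set (down_path G r w)"
  shows "u \<in> set (down_path G r v)"
proof -
  obtain a b where ab: "down_path G r v = a @ w # b" using split_list[OF assms(3)] by blast
  then show ?thesis using down_path_suffix[OF assms(1,2) ab] assms(4) by auto
qed

section \<open>Agreement on upper sets\<close>

text \<open>Closure is towards the leaves because grains move towards the root: nothing outside such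
  a set can send a grain into it.\<close>

definition upper_set :: "'a pair_pre_digraph \<Rightarrow> 'a \<Rightarrow> 'a set \<Rightarrow> bool" where
  "upper_set G r U \<longleftrightarrow> (\<forall>v\<in>pverts G. \<forall>w\<in>set (down_path G r v). w \<in> U \<longrightarrow> v \<in> U)"

text \<open>A down path that has left \<open>U\<close> never re-enters it. The
  \<open>sorted_wrt\<close> form is inherited by tails, as inductions along the list
  require.\<close>

lemma sorted_wrt_upper_set:
  assumes arb: "arborescence G r" and v: "v \<in> pverts G" and U: "upper_set G r U"
  shows "sorted_wrt (\<lambda>a b. b \<in> U \<longrightarrow> a \<in> U) (down_path G r v)"
proof -
  have "sorted_wrt (\<lambda>a b. b \<in> U \<longrightarrow> a \<in> U) q" if "down_path G r v = p @ q" for p q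
    using that
  proof (induction q arbitrary: p)
    case (Cons a q)
    have "a \<in> pverts G" using set_down_path_subset[OF arb v] Cons.prems by auto
    moreover have "set q \<subseteq> set (down_path G r a)"
      by (subst down_path_suffix[OF arb v Cons.prems]) auto
    ultimately have "\<forall>b\<in>set q. b \<in> U \<longrightarrow> a \<in> U"
      using U unfolding upper_set_def by blast
    moreover have "sorted_wrt (\<lambda>a b. b \<in> U \<longrightarrow> a \<in> U) q"
      using Cons.IH[of "p @ [a]"] Cons.prems by simp
    ultimately show ?case by simp
  qed simp
  from this[of "[]" "down_path G r v"] show ?thesis by simp
qed

section \<open>Operators on states that agree on an upper set\<close>

lemma add_grain_simps:
  "add_grain T [] t = t"
  "add_grain T (v # vs) t = (if t v < T v then t(v := t v + 1) else add_grain T vs t)"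
  by (auto simp: add_grain_def)

lemma add_grain_notin:
  "w \<notin> set vs \<Longrightarrow> add_grain T vs t w = t w"
  by (induction vs) (auto simp: add_grain_simps)

text \<open>The search for a vertex below threshold visits the members of \<open>U\<close> first and
  gets the same answers from both states; once it is past them, it changes nothing on
  \<open>U\<close>.\<close>

lemma add_grain_agree:
  assumes "\<forall>w\<in>U. t w = t' w" and "sorted_wrt (\<lambda>a b. b \<in> U \<longrightarrow> a \<in> U) vs" and "w \<in> U"
  shows "add_grain T vs t w = add_grain T vs t' w"
  using assms
proof (induction vs)
  case (Cons v vs)
  show ?case
  proof (cases "v \<in> U")
    case False
    \<comment> \<open>Sortedness puts every later vertex outside \<open>U\<close> as well, so the
      grain cannot land on \<open>w\<close>.\<close>
    then have "w \<notin> set (v # vs)" using Cons.prems by auto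
    then show ?thesis using Cons.prems add_grain_notin[of w "v # vs" T] by simp
  qed (use Cons in \<open>auto simp: add_grain_simps\<close>)
qed (simp add: add_grain_simps)

text \<open>If \<open>v\<close> is in \<open>U\<close>, both copies lose a grain there or neither
  does, and the grain travels alike within \<open>U\<close>; if not, the whole path avoids
  \<open>U\<close>.\<close>

lemma theta_op_agree:
  assumes arb: "arborescence G r" and v: "v \<in> pverts G" and U: "upper_set G r U"
    and ag: "\<forall>w\<in>U. t w = t' w" and w: "w \<in> U"
  shows "theta_op G r T v t w = theta_op G r T v t' w"
proof -
  obtain p where p: "down_path G r v = v # p" by (rule down_path_Cons[OF arb v])
  have s: "sorted_wrt (\<lambda>a b. b \<in> U \<longrightarrow> a \<in> U) (v # p)"
    using sorted_wrt_upper_set[OF arb v U] by (simp add: p)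
  show ?thesis
  proof (cases "v \<in> U")
    case True
    then show ?thesis
      using ag w s by (auto simp: theta_op_def p intro!: add_grain_agree[of U])
  next
    case False
    then have "w \<noteq> v" "w \<notin> set p" using s w by auto
    then show ?thesis using ag w by (auto simp: theta_op_def p add_grain_notin)
  qed
qed

lemma topple_op_agree:
  assumes "arborescence G r" and "v \<in> pverts G" and "upper_set G r U"
    and "\<forall>w\<in>U. t w = t' w" and "w \<in> U"
  shows "topple_op G r T v t w = topple_op G r T v t' w"
proof -
  have "\<forall>w\<in>U. (theta_op G r T v ^^ m) t w = (theta_op G r T v ^^ m) t' w" for m
  proof (induction m)
    case (Suc m)
    then show ?case using theta_op_agree[OF assms(1-3) Suc.IH] by simp
  qed (simp add: assms(4))
  then show ?thesis using assms(5) by (simp add: topple_op_def)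
qed

text \<open>Truncated subtraction covers the idle case \<open>t v = 0\<close>; the moved grain
  cannot return to \<open>v\<close> because the path is distinct.\<close>

lemma theta_op_self:
  assumes "arborescence G r" and "v \<in> pverts G"
  shows "theta_op G r T v t v = t v - 1"
proof -
  obtain p where p: "down_path G r v = v # p" by (rule down_path_Cons[OF assms])
  then have "v \<notin> set p" using distinct_down_path[OF assms] by simp
  then show ?thesis by (simp add: theta_op_def p add_grain_notin)
qed

lemma topple_op_self:
  assumes "arborescence G r" and "v \<in> pverts G" and "t v \<le> T v"
  shows "topple_op G r T v t v = 0"
proof -
  have "(theta_op G r T v ^^ m) t v = t v - m" for m
    by (induction m) (simp_all add: theta_op_self[OF assms(1,2)])
  then show ?thesis using assms(3) by (simp add: topple_op_def)
qed

section \<open>Moves\<close>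

text \<open>The type \<open>move\<close> also contains moves at points off the graph; those have
  weight 0 and are left out.\<close>

definition moves :: "'a pair_pre_digraph \<Rightarrow> 'a move set" where
  "moves G = Topple ` pverts G \<union> Source ` leaves G"

lemma apply_move_agree:
  assumes "arborescence G r" and "m \<in> moves G" and "upper_set G r U"
    and "\<forall>w\<in>U. t w = t' w" and "w \<in> U"
  shows "apply_move G r T m t w = apply_move G r T m t' w"
proof (cases m)
  case (Topple v)
  then show ?thesis using assms by (auto simp: moves_def intro: topple_op_agree)
next
  case (Source l)
  then have "l \<in> pverts G" using assms(2) by (auto simp: moves_def leaves_def)
  then show ?thesis
    using add_grain_agree[OF assms(4) sorted_wrt_upper_set[OF assms(1) _ assms(3)] assms(5)]
    by (simp add: Source source_op_def)
qed

section \<open>Invariance and finiteness of the state space\<close>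

lemma add_grain_states:
  "t \<in> states G T \<Longrightarrow> set vs \<subseteq> pverts G \<Longrightarrow> add_grain T vs t \<in> states G T"
  by (induction vs) (auto simp: add_grain_simps states_def PiE_iff extensional_def)

lemma theta_op_states:
  assumes "arborescence G r" and "v \<in> pverts G" and "t \<in> states G T"
  shows "theta_op G r T v t \<in> states G T"
proof -
  have "t(v := t v - 1) \<in> states G T"
    using assms(2,3) by (force simp: states_def PiE_iff extensional_def)
  moreover have "set (tl (down_path G r v)) \<subseteq> pverts G"
    using set_down_path_subset[OF assms(1,2)] by (metis list.set_sel(2) subset_iff tl_Nil)
  ultimately show ?thesis using assms(3) by (simp add: theta_op_def add_grain_states)
qed

lemma apply_move_states:
  assumes "arborescence G r" and "m \<in> moves G" and "t \<in> states G T"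
  shows "apply_move G r T m t \<in> states G T"
proof -
  have "(theta_op G r T v ^^ j) t \<in> states G T" if "v \<in> pverts G" for v j
    by (induction j) (use assms that theta_op_states in auto)
  moreover have "source_op G r T l t \<in> states G T" if "l \<in> leaves G" for l
    using that assms set_down_path_subset[OF assms(1), of l]
    by (simp add: source_op_def add_grain_states leaves_def)
  ultimately show ?thesis using assms(2) by (auto simp: moves_def topple_op_def)
qed

lemma finite_states:
  assumes "arborescence G r"
  shows "finite (states G T)"
  unfolding states_def using finite_pverts[OF assms] by (intro finite_PiE) auto

section \<open>The agreement set of two states\<close>

text \<open>Explicit form of the largest upper set of vertices on which the states agree:
  \<open>v\<close> belongs to it when they coincide on everything above \<open>v\<close> in the tree
  order, \<open>v\<close> included.\<close>

definition agreement ::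
  "'a pair_pre_digraph \<Rightarrow> 'a \<Rightarrow> ('a \<Rightarrow> nat) \<Rightarrow> ('a \<Rightarrow> nat) \<Rightarrow> 'a set" where
  "agreement G r t t' =
     {v \<in> pverts G. \<forall>u\<in>pverts G. v \<in> set (down_path G r u) \<longrightarrow> t u = t' u}"

lemma agreement_subset: "agreement G r t t' \<subseteq> pverts G"
  by (auto simp: agreement_def)

lemma finite_agreement:
  assumes "arborescence G r"
  shows "finite (agreement G r t t')"
  using finite_subset[OF agreement_subset finite_pverts[OF assms]] .

lemma agreement_maximal:
  assumes "upper_set G r U" and "U \<subseteq> pverts G" and "\<forall>u\<in>U. t u = t' u"
  shows "U \<subseteq> agreement G r t t'"
  using assms by (auto simp: upper_set_def agreement_def)

lemma upper_set_agreement: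
  assumes "arborescence G r"
  shows "upper_set G r (agreement G r t t')"
  using down_path_trans[OF assms] by (auto simp: upper_set_def agreement_def)

lemma agreement_eq:
  assumes "arborescence G r" and "v \<in> agreement G r t t'"
  shows "t v = t' v"
  using assms(2) down_path_Cons[OF assms(1), of v]
  unfolding agreement_def by (metis (mono_tags, lifting) list.set_intros(1) mem_Collect_eq)

text \<open>The old agreement set is an upper set on which the images still agree, so maximality of
  the new one contains it.\<close>

lemma agreement_mono:
  assumes "arborescence G r" and "m \<in> moves G"
  shows "agreement G r t t' \<subseteq> agreement G r (apply_move G r T m t) (apply_move G r T m t')"
  by (intro agreement_maximal upper_set_agreement agreement_subset ballI)
    (use assms in \<open>auto intro: apply_move_agree upper_set_agreement agreement_eq\<close>)

lemma exists_growing_topple: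
  assumes arb: "arborescence G r" and ne: "agreement G r t t' \<noteq> pverts G"
    and t: "t \<in> states G T" "t' \<in> states G T"
  shows "\<exists>v\<in>pverts G. agreement G r t t' \<subset> agreement G r (topple_op G r T v t) (topple_op G r T v t')"
proof -
  let ?A = "agreement G r t t'"
  have "finite (pverts G - ?A)" "pverts G - ?A \<noteq> {}"
    using finite_pverts[OF arb] ne agreement_subset[of G r t t'] by auto
  \<comment> \<open>The vertex to topple is a deepest one outside \<open>?A\<close>.\<close>
  then have "Max ((\<lambda>u. length (down_path G r u)) ` (pverts G - ?A))
      \<in> (\<lambda>u. length (down_path G r u)) ` (pverts G - ?A)"
    by (intro Max_in) auto
  then obtain v where v: "v \<in> pverts G - ?A"
    and "Max ((\<lambda>u. length (down_path G r u)) ` (pverts G - ?A)) = length (down_path G r v)"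
    by blast
  then have v_max: "length (down_path G r u) \<le> length (down_path G r v)"
    if "u \<in> pverts G - ?A" for u
    using that \<open>finite (pverts G - ?A)\<close> by (metis Max_ge finite_imageI imageI)
  \<comment> \<open>A vertex strictly above \<open>v\<close> is deeper than \<open>v\<close>, so by
    the choice of \<open>v\<close> it already lies in \<open>?A\<close>. Hence adding
    \<open>v\<close> keeps the set upper.\<close>
  have up: "u \<in> insert v ?A" if "u \<in> pverts G" "v \<in> set (down_path G r u)" for u
    using length_down_path_less[OF arb that] v_max[of u] that by fastforce
  have U: "upper_set G r (insert v ?A)"
    using upper_set_agreement[OF arb, of t t'] up by (auto simp: upper_set_def)
  have "topple_op G r T v t u = topple_op G r T v t' u" if "u \<in> insert v ?A" for u
  proof (cases "u = v")
    case True
    then show ?thesis using v t by (auto simp: topple_op_self[OF arb] states_def PiE_iff)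
  next
    case False
    then show ?thesis
      using that v agreement_eq[OF arb]
      by (intro topple_op_agree[OF arb _ upper_set_agreement[OF arb, of t t']]) auto
  qed
  then have "insert v ?A \<subseteq> agreement G r (topple_op G r T v t) (topple_op G r T v t')"
    using U v agreement_subset[of G r t t'] by (intro agreement_maximal) auto
  then show ?thesis using v by blast
qed

section \<open>Couplings\<close>

text \<open>The coupling inequality: contributions from the diagonal cancel, and each marginal
  contributes at most the off-diagonal mass, which the factor 1/2 compensates.\<close>

lemma tv_dist_coupling:
  assumes "finite S"
  shows "tv_dist S (map_pmf fst D) (map_pmf snd D) \<le> measure_pmf.prob D {z. fst z \<noteq> snd z}"
proof -
  let ?P = "measure_pmf.prob D"
  let ?B = "{z. fst z \<noteq> snd z}"
  have split: "?P E = ?P (E \<inter> ?B) + ?P (E - ?B)" for E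
    using measure_pmf.finite_measure_Diff'[of E D ?B] by simp
  \<comment> \<open>For distinct \<open>s\<close> these events are disjoint subsets of
    \<open>?B\<close>.\<close>
  have part: "(\<Sum>s\<in>S. ?P ({z. f z = s} \<inter> ?B)) \<le> ?P ?B" for f :: "_ \<Rightarrow> 'a"
  proof -
    have "(\<Sum>s\<in>S. ?P ({z. f z = s} \<inter> ?B)) = ?P (\<Union>s\<in>S. {z. f z = s} \<inter> ?B)"
      by (rule measure_pmf.finite_measure_finite_Union[symmetric])
        (auto simp: assms disjoint_family_on_def)
    also have "\<dots> \<le> ?P ?B" by (rule measure_pmf.finite_measure_mono) auto
    finally show ?thesis .
  qed
  have "\<bar>pmf (map_pmf fst D) s - pmf (map_pmf snd D) s\<bar>
      \<le> ?P ({z. fst z = s} \<inter> ?B) + ?P ({z. snd z = s} \<inter> ?B)" for s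
  proof -
    have "{z. fst z = s} - ?B = {z. snd z = s} - ?B" by auto
    then show ?thesis
      using split[of "{z. fst z = s}"] split[of "{z. snd z = s}"]
      by (simp add: pmf_map vimage_def abs_le_iff)
  qed
  then have "(\<Sum>s\<in>S. \<bar>pmf (map_pmf fst D) s - pmf (map_pmf snd D) s\<bar>)
      \<le> (\<Sum>s\<in>S. ?P ({z. fst z = s} \<inter> ?B) + ?P ({z. snd z = s} \<inter> ?B))"
    by (rule sum_mono)
  also have "\<dots> \<le> ?P ?B + ?P ?B"
    using part[of fst] part[of snd] by (simp add: sum.distrib)
  finally show ?thesis by (simp add: tv_dist_def)
qed

text \<open>If \<open>f\<close> carries each step of \<open>C\<close> to a step of \<open>K\<close>,
  it carries the whole chain; with \<open>fst\<close> and \<open>snd\<close> this recovers the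
  marginals of a coupling.\<close>

lemma map_distribution_after:
  assumes "\<And>z. map_pmf f (C z) = K (f z)"
  shows "map_pmf f (distribution_after C D k) = distribution_after K (map_pmf f D) k"
proof (induction k)
  case (Suc k)
  have "map_pmf f (distribution_after C D (Suc k)) =
      bind_pmf (map_pmf f (distribution_after C D k)) K"
    by (simp add: distribution_after_def map_bind_pmf assms bind_map_pmf)
  then show ?case unfolding Suc.IH by (simp add: distribution_after_def)
qed (simp add: distribution_after_def)

lemma distribution_after_stationary:
  assumes "stationary_distribution S K p"
  shows "distribution_after K p k = p"
  by (induction k) (use assms in \<open>simp_all add: distribution_after_def stationary_distribution_def\<close>)

lemma distribution_after_invariant:
  assumes "\<And>z. z \<in> I \<Longrightarrow> set_pmf (C z) \<subseteq> I" and "set_pmf D \<subseteq> I"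
  shows "set_pmf (distribution_after C D k) \<subseteq> I"
  by (induction k) (use assms in \<open>fastforce simp: distribution_after_def\<close>)+

text \<open>Iterated drift bound. The invariant set \<open>I\<close> is carried along because the
  one-step bound is assumed only there.\<close>

lemma nn_integral_distribution_after_le:
  fixes h :: "'s \<Rightarrow> ennreal"
  assumes inv: "\<And>z. z \<in> I \<Longrightarrow> set_pmf (C z) \<subseteq> I" "set_pmf D \<subseteq> I"
    and contr: "\<And>z. z \<in> I \<Longrightarrow> (\<integral>\<^sup>+w. h w \<partial>C z) \<le> c * h z"
  shows "(\<integral>\<^sup>+z. h z \<partial>distribution_after C D k) \<le> c ^ k * (\<integral>\<^sup>+z. h z \<partial>D)"
proof (induction k)
  case (Suc k)
  let ?D = "distribution_after C D k"
  have "(\<integral>\<^sup>+z. h z \<partial>distribution_after C D (Suc k)) = (\<integral>\<^sup>+z. \<integral>\<^sup>+w. h w \<partial>C z \<partial>?D)"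
    by (simp add: distribution_after_def)
  also have "\<dots> \<le> (\<integral>\<^sup>+z. c * h z \<partial>?D)"
    using distribution_after_invariant[of I C, OF inv] contr
    by (intro nn_integral_mono_AE) (auto simp: AE_measure_pmf_iff)
  also have "\<dots> = c * (\<integral>\<^sup>+z. h z \<partial>?D)" by (simp add: nn_integral_cmult)
  also have "\<dots> \<le> c * (c ^ k * (\<integral>\<^sup>+z. h z \<partial>D))" by (intro mult_left_mono Suc.IH) simp
  finally show ?case by (simp add: mult.assoc)
qed (simp add: distribution_after_def)

section \<open>The exponential potential\<close>

text \<open>The Chernoff weight with parameter \<open>s\<close>. The value 0 at full agreement keeps
  the contraction valid once the set can no longer grow.\<close>

definition potential :: "'a pair_pre_digraph \<Rightarrow> 'a \<Rightarrow> real \<Rightarrow> ('a \<Rightarrow> nat) \<times> ('a \<Rightarrow> nat) \<Rightarrow> real" where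
  "potential G r s z =
     (let A = agreement G r (fst z) (snd z) in if A = pverts G then 0 else exp (- s * card A))"

lemma potential_nonneg: "0 \<le> potential G r s z"
  by (simp add: potential_def Let_def)

lemma potential_le_1: "0 \<le> s \<Longrightarrow> potential G r s z \<le> 1"
  by (simp add: potential_def Let_def)

lemma potential_mono:
  assumes "arborescence G r" and "0 \<le> s"
    and "agreement G r (fst z) (snd z) \<subseteq> agreement G r (fst z') (snd z')"
  shows "potential G r s z' \<le> potential G r s z"
proof -
  have "card (agreement G r (fst z) (snd z)) \<le> card (agreement G r (fst z') (snd z'))"
    using assms finite_agreement by (intro card_mono)
  then show ?thesis
    using assms(2,3) agreement_subset[of G r "fst z'" "snd z'"]
    by (auto simp: potential_def Let_def intro: mult_left_mono)
qed

lemma potential_strict: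
  assumes "arborescence G r" and "0 \<le> s"
    and "agreement G r (fst z) (snd z) \<subset> agreement G r (fst z') (snd z')"
  shows "potential G r s z' \<le> exp (- s) * potential G r s z"
proof -
  have "Suc (card (agreement G r (fst z) (snd z))) \<le> card (agreement G r (fst z') (snd z'))"
    using assms finite_agreement by (intro Suc_leI psubset_card_mono)
  then have "s * (1 + card (agreement G r (fst z) (snd z))) \<le> s * card (agreement G r (fst z') (snd z'))"
    using assms(2) by (intro mult_left_mono) linarith+
  then show ?thesis
    using assms(3) agreement_subset[of G r "fst z'" "snd z'"]
    by (auto simp: potential_def Let_def algebra_simps simp flip: exp_add)
qed

text \<open>Distinct states leave at least one vertex outside the agreement set; this is where
  \<open>n - 1\<close> in the final bound comes from.\<close>

lemma potential_ge:
  assumes "arborescence G r" and "0 \<le> s"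
    and "t \<in> states G T" and "t' \<in> states G T" and "t \<noteq> t'"
  shows "exp (- s * (real (card (pverts G)) - 1)) \<le> potential G r s (t, t')"
proof -
  \<comment> \<open>States are extensional functions, so agreement on all vertices would make them
    equal.\<close>
  have ne: "agreement G r t t' \<noteq> pverts G"
    using assms(3-5) agreement_eq[OF assms(1), of _ t t'] by (auto simp: states_def intro: PiE_ext)
  then have "card (agreement G r t t') < card (pverts G)"
    using agreement_subset[of G r t t'] finite_pverts[OF assms(1)] by (intro psubset_card_mono) auto
  then have "s * card (agreement G r t t') \<le> s * (real (card (pverts G)) - 1)"
    using assms(2) by (intro mult_left_mono) linarith+
  then show ?thesis using ne by (simp add: potential_def Let_def)
qed

text \<open>Multiplying by the Taylor lower bound of \<open>exp s\<close> gives
  \<open>(1 + s^2/2)^2 - s^2 = 1 + s^4/4\<close>, which is at least 1.\<close>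

lemma exp_minus_le_quadratic:
  fixes s :: real
  assumes "0 \<le> s"
  shows "exp (- s) \<le> 1 - s + s\<^sup>2 / 2"
proof -
  have nn: "0 \<le> 1 - s + s\<^sup>2 / 2" using sum_squares_bound[of 1 s] zero_le_power2[of "s - 1"]
    by (simp add: power2_eq_square algebra_simps)
  have "1 \<le> (1 - s + s\<^sup>2 / 2) * (1 + s + s\<^sup>2 / 2)"
    using assms by (simp add: algebra_simps power2_eq_square)
  also have "\<dots> \<le> (1 - s + s\<^sup>2 / 2) * exp s"
    using nn exp_lower_Taylor_quadratic[OF assms] by (intro mult_left_mono) auto
  finally show ?thesis by (simp add: exp_minus field_simps)
qed

section \<open>The coupled kernel and the drift of the potential\<close>

lemma set_move_pmf_subset:
  assumes "finite (pverts G)"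
    and "\<And>v. v \<in> pverts G \<Longrightarrow> 0 < x v" and "\<And>l. l \<in> leaves G \<Longrightarrow> 0 < y l"
    and "(\<Sum>v\<in>pverts G. x v) + (\<Sum>l\<in>leaves G. y l) = 1"
  shows "set_pmf (move_pmf G x y) \<subseteq> moves G"
proof
  fix m assume "m \<in> set_pmf (move_pmf G x y)"
  then have "move_weight G x y m \<noteq> 0"
    by (simp add: set_pmf_iff pmf_move_pmf[OF assms])
  then show "m \<in> moves G" by (cases m) (auto simp: moves_def split: if_splits)
qed

definition coupled_kernel ::
  "'a pair_pre_digraph \<Rightarrow> 'a \<Rightarrow> ('a \<Rightarrow> nat) \<Rightarrow> ('a \<Rightarrow> real) \<Rightarrow> ('a \<Rightarrow> real) \<Rightarrow>
     ('a \<Rightarrow> nat) \<times> ('a \<Rightarrow> nat) \<Rightarrow> (('a \<Rightarrow> nat) \<times> ('a \<Rightarrow> nat)) pmf" where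
  "coupled_kernel G r T x y z =
     map_pmf (\<lambda>m. map_prod (apply_move G r T m) (apply_move G r T m) z) (move_pmf G x y)"

text \<open>Some topple of probability at least \<open>p\<close> scales the potential by at most
  \<open>exp (- s)\<close>, and no other move raises it; averaging gives
  \<open>(1 - p) + p * exp (- s)\<close>.\<close>

lemma potential_contraction:
  assumes arb: "arborescence G r"
    and x: "\<And>v. v \<in> pverts G \<Longrightarrow> 0 < x v" and y: "\<And>l. l \<in> leaves G \<Longrightarrow> 0 < y l"
    and sum1: "(\<Sum>v\<in>pverts G. x v) + (\<Sum>l\<in>leaves G. y l) = 1"
    and p: "\<And>v. v \<in> pverts G \<Longrightarrow> p \<le> x v"
    and s: "0 \<le> s" and z: "z \<in> states G T \<times> states G T"
  shows "(\<integral>\<^sup>+w. ennreal (potential G r s w) \<partial>coupled_kernel G r T x y z)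
    \<le> ennreal (1 - p * (1 - exp (- s))) * ennreal (potential G r s z)"
proof -
  let ?M = "move_pmf G x y" and ?h = "potential G r s"
  let ?f = "\<lambda>m. map_prod (apply_move G r T m) (apply_move G r T m) z"
  have sub: "set_pmf ?M \<subseteq> moves G"
    using set_move_pmf_subset[OF finite_pverts[OF arb] x y sum1] .
  have mono: "?h (?f m) \<le> ?h z" if "m \<in> moves G" for m
    using agreement_mono[OF arb that] by (intro potential_mono[OF arb s]) simp
  show ?thesis
  proof (cases "agreement G r (fst z) (snd z) = pverts G")
    case True
    then have "?h z = 0" by (simp add: potential_def)
    \<comment> \<open>Copies that have merged stay merged.\<close>
    then have "?h (?f m) = 0" if "m \<in> moves G" for m
      using mono[OF that] potential_nonneg[of G r s] by (simp add: order.antisym)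
    then have "(\<integral>\<^sup>+w. ennreal (?h w) \<partial>coupled_kernel G r T x y z) = (\<integral>\<^sup>+m. 0 \<partial>?M)"
      unfolding coupled_kernel_def nn_integral_map_pmf
      using sub by (intro nn_integral_cong_AE) (auto simp: AE_measure_pmf_iff)
    then show ?thesis by simp
  next
    case False
    obtain v where v: "v \<in> pverts G" and grow: "agreement G r (fst z) (snd z) \<subset>
        agreement G r (topple_op G r T v (fst z)) (topple_op G r T v (snd z))"
      using exists_growing_topple[OF arb False, of T] z by (auto simp: mem_Times_iff)
    \<comment> \<open>Majorant of the potential after move \<open>m\<close>: the factor is
      \<open>exp (- s)\<close> at \<open>Topple v\<close> and 1 elsewhere.\<close>
    let ?g = "\<lambda>m. ?h z * (1 - (1 - exp (- s)) * indicator {Topple v} m)"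
    have g: "?h (?f m) \<le> ?g m" if "m \<in> moves G" for m
      using potential_strict[OF arb s, of z "?f (Topple v)"] grow mono[OF that]
      by (cases "m = Topple v") (auto simp: mult.commute)
    have gnn: "0 \<le> ?g m" for m
      using potential_nonneg[of G r s z] s by (auto simp: indicator_def)
    have int: "integrable ?M (indicat_real {Topple v})"
      by (auto simp: less_top[symmetric] intro!: integrable_real_indicator)
    have "(\<integral>\<^sup>+w. ennreal (?h w) \<partial>coupled_kernel G r T x y z) \<le> (\<integral>\<^sup>+m. ennreal (?g m) \<partial>?M)"
      unfolding coupled_kernel_def nn_integral_map_pmf
      using sub g by (intro nn_integral_mono_AE) (auto simp: AE_measure_pmf_iff intro!: ennreal_leI)
    also have "\<dots> = ennreal (\<integral>m. ?g m \<partial>?M)"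
      by (intro nn_integral_eq_integral integrable_mult_right Bochner_Integration.integrable_diff)
        (auto simp: gnn int)
    also have "(\<integral>m. ?g m \<partial>?M) = ?h z * (1 - (1 - exp (- s)) * x v)"
      using pmf_move_pmf[OF finite_pverts[OF arb] x y sum1, of "Topple v"] v
      by (simp add: int Bochner_Integration.integral_diff measure_pmf_single)
    also have "ennreal \<dots> \<le> ennreal ((1 - p * (1 - exp (- s))) * ?h z)"
      using p[OF v] s potential_nonneg[of G r s z] mult_right_mono[of p "x v" "1 - exp (- s)"]
      by (intro ennreal_leI) (simp add: mult.commute mult_left_mono)
    also have "\<dots> = ennreal (1 - p * (1 - exp (- s))) * ennreal (?h z)"
      using potential_nonneg by (rule ennreal_mult'')
    finally show ?thesis .
  qed
qed

section \<open>The Chernoff bound for the time to merge\<close>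

theorem theorem2p11:
  fixes G :: "'a pair_pre_digraph" and r :: 'a and T :: "'a \<Rightarrow> nat"
    and x y :: "'a \<Rightarrow> real" and \<pi> \<mu> :: "('a \<Rightarrow> nat) pmf" and k n :: nat and px :: real
  assumes "arborescence G r"
    and "\<And>v. v \<in> pverts G \<Longrightarrow> 0 < T v"
    and "\<And>v. v \<in> pverts G \<Longrightarrow> 0 < x v \<and> x v \<le> 1"
    and "\<And>l. l \<in> leaves G \<Longrightarrow> 0 < y l \<and> y l \<le> 1"
    and "(\<Sum>v\<in>pverts G. x v) + (\<Sum>l\<in>leaves G. y l) = 1"
    and "stationary_distribution (states G T) (landslide_kernel G r T x y) \<pi>"
    and "set_pmf \<mu> \<subseteq> states G T"
    and "px = Min (x ` pverts G)"
    and "n = card (pverts G)"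
    and "0 < k"
    and "real k \<ge> (real n - 1) / px"
  shows "tv_dist (states G T) (distribution_after (landslide_kernel G r T x y) \<mu> k) \<pi>
       \<le> exp (- ((real k * px - (real n - 1))\<^sup>2 / (2 * real k * px)))"
proof -
  note arb = assms(1)
  let ?S = "states G T" and ?K = "landslide_kernel G r T x y" and ?C = "coupled_kernel G r T x y"
  \<comment> \<open>\<open>b\<close> is the mean of a binomial \<open>(k, px)\<close>
    variable.\<close>
  define b where "b = real k * px"
  define m where "m = real n - 1"
  \<comment> \<open>The minimiser of the exponent \<open>s * m - b * (s - s^2/2)\<close> reached at
    the end.\<close>
  define s where "s = (b - m) / b"
  define c where "c = 1 - px * (1 - exp (- s))"
  \<comment> \<open>Independent start: the first copy from \<open>\<mu>\<close>, the second from
    \<open>\<pi>\<close>, whose law does not change.\<close>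
  define D where "D = distribution_after ?C (pair_pmf \<mu> \<pi>) k"
  have x: "\<And>v. v \<in> pverts G \<Longrightarrow> 0 < x v" and y: "\<And>l. l \<in> leaves G \<Longrightarrow> 0 < y l"
    using assms(3,4) by auto
  have fin: "finite (pverts G)" and r: "r \<in> pverts G"
    using finite_pverts[OF arb] arb by (auto simp: arborescence_def)
  have px_le: "px \<le> x v" if "v \<in> pverts G" for v
    using that fin by (simp add: assms(8))
  have px_pos: "0 < px" unfolding assms(8) using fin r x by (subst Min_gr_iff) auto
  have px1: "px \<le> 1" using px_le[OF r] assms(3)[OF r] by simp
  have b: "0 < b" using px_pos assms(10) by (simp add: b_def)
  \<comment> \<open>The lower bound on \<open>k\<close> is exactly what makes \<open>s\<close>
    nonnegative.\<close>
  have "m \<le> b" using assms(11) px_pos by (simp add: m_def b_def field_simps)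
  then have s: "0 \<le> s" using b by (simp add: s_def)
  have "px * (1 - exp (- s)) \<le> 1 * 1"
    using px_pos px1 s by (intro mult_mono) auto
  then have c: "0 \<le> c" by (simp add: c_def)

  have inv: "set_pmf (?C z) \<subseteq> ?S \<times> ?S" if "z \<in> ?S \<times> ?S" for z
    using that set_move_pmf_subset[OF fin x y assms(5)] apply_move_states[OF arb]
    by (fastforce simp: coupled_kernel_def)
  have init: "set_pmf (pair_pmf \<mu> \<pi>) \<subseteq> ?S \<times> ?S"
    using assms(6,7) by (auto simp: stationary_distribution_def)
  have D_sub: "set_pmf D \<subseteq> ?S \<times> ?S"
    unfolding D_def by (rule distribution_after_invariant[OF inv init])

  have "(\<integral>\<^sup>+z. ennreal (potential G r s z) \<partial>D)
      \<le> ennreal c ^ k * (\<integral>\<^sup>+z. ennreal (potential G r s z) \<partial>pair_pmf \<mu> \<pi>)"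
    unfolding D_def c_def
    by (intro nn_integral_distribution_after_le[OF inv init]
        potential_contraction[OF arb x y assms(5) px_le s])
  also have "\<dots> \<le> ennreal c ^ k * (\<integral>\<^sup>+z. 1 \<partial>pair_pmf \<mu> \<pi>)"
    using potential_le_1[OF s] by (intro mult_left_mono nn_integral_mono) auto
  finally have pot: "(\<integral>\<^sup>+z. ennreal (potential G r s z) \<partial>D) \<le> ennreal (c ^ k)"
    using c by (simp add: ennreal_power)

  \<comment> \<open>Markov's inequality in pointwise form: the scaled potential is at least 1
    wherever the copies differ.\<close>
  have ge: "indicator {z. fst z \<noteq> snd z} z \<le> exp (s * m) * potential G r s z"
    if "z \<in> ?S \<times> ?S" for z
  proof (cases "fst z = snd z")
    case False
    then have "exp (- s * m) \<le> potential G r s z"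
      using potential_ge[OF arb s, of "fst z" T "snd z"] that
      by (simp add: m_def assms(9) mem_Times_iff)
    then have "exp (s * m) * exp (- s * m) \<le> exp (s * m) * potential G r s z"
      by (intro mult_left_mono) auto
    then show ?thesis using False by (simp flip: exp_add)
  qed (simp add: potential_nonneg)
  have "ennreal (measure_pmf.prob D {z. fst z \<noteq> snd z})
      = (\<integral>\<^sup>+z. ennreal (indicator {z. fst z \<noteq> snd z} z) \<partial>D)"
    by (simp add: measure_pmf.emeasure_eq_measure ennreal_indicator)
  also have "\<dots> \<le> (\<integral>\<^sup>+z. ennreal (exp (s * m)) * ennreal (potential G r s z) \<partial>D)"
    using D_sub ge
    by (intro nn_integral_mono_AE)
      (auto simp: AE_measure_pmf_iff simp flip: ennreal_mult' intro!: ennreal_leI)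
  also have "\<dots> = ennreal (exp (s * m)) * (\<integral>\<^sup>+z. ennreal (potential G r s z) \<partial>D)"
    by (simp add: nn_integral_cmult)
  also have "\<dots> \<le> ennreal (exp (s * m) * c ^ k)"
    using mult_left_mono[OF pot, of "ennreal (exp (s * m))"] by (simp add: ennreal_mult')
  finally have "measure_pmf.prob D {z. fst z \<noteq> snd z} \<le> exp (s * m) * c ^ k"
    using c by simp
  also have "\<dots> \<le> exp (s * m) * exp (- (b * (1 - exp (- s))))"
  proof -
    \<comment> \<open>Uses \<open>1 - a \<le> exp (- a)\<close> in each of the \<open>k\<close>
      factors.\<close>
    have "c ^ k \<le> exp (- (px * (1 - exp (- s)))) ^ k"
      using c exp_ge_add_one_self[of "- (px * (1 - exp (- s)))"]
      by (intro power_mono) (auto simp: c_def)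
    then show ?thesis by (simp add: b_def mult.assoc flip: exp_of_nat_mult)
  qed
  also have "\<dots> \<le> exp (- ((b - m)\<^sup>2 / (2 * b)))"
  proof -
    have "b * (s - s\<^sup>2 / 2) \<le> b * (1 - exp (- s))"
      using exp_minus_le_quadratic[OF s] b by (intro mult_left_mono) auto
    \<comment> \<open>With the chosen \<open>s\<close>, the quadratic exponent takes its minimal
      value.\<close>
    moreover have "s * m - b * (s - s\<^sup>2 / 2) = - ((b - m)\<^sup>2 / (2 * b))"
      using b by (simp add: s_def power2_eq_square field_simps)
    ultimately show ?thesis by (simp flip: exp_add)
  qed
  finally have prob: "measure_pmf.prob D {z. fst z \<noteq> snd z} \<le> exp (- ((b - m)\<^sup>2 / (2 * b)))" .

  have "map_pmf fst D = distribution_after ?K \<mu> k"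
    unfolding D_def
    by (subst map_distribution_after[where K = ?K])
      (simp_all add: coupled_kernel_def landslide_kernel_def pmf.map_comp o_def map_fst_pair_pmf)
  moreover have "map_pmf snd D = distribution_after ?K \<pi> k"
    unfolding D_def
    by (subst map_distribution_after[where K = ?K])
      (simp_all add: coupled_kernel_def landslide_kernel_def pmf.map_comp o_def map_snd_pair_pmf)
  ultimately show ?thesis
    using tv_dist_coupling[OF finite_states[OF arb, of T], of D] prob
      distribution_after_stationary[OF assms(6), of k]
    by (simp add: b_def m_def mult.assoc)
qed

end
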